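(* Let $0<r<1$, let $I=[-1,1]$, and let $f:I\to I$ be given by $f(x)=r\,x\sin\frac{1}{x}$ for $x\neq 0$ and $f(0)=0$. Then $f\in\mathcal{F}_1$, i.e. $f$ is continuous and does not admit a $2$-cycle, and $f$ has the following universal property: for every continuous map $g:[-1,1]\to[-1,1]$ that does not admit a $2$-cycle and every $p\in I$, there exists $q\in I$ such that the sequences $(g^n(p))_{n=0}^{\infty}$ and $(f^n(q))_{n=0}^{\infty}$ have the same order-pattern.
   Context: A $2$-cycle of a map $h$ is a pair of distinct points $u\neq v$ with $h(u)=v$ and $h(v)=u$. $\mathcal{F}_1$ denotes the set of continuous self-maps of the interval $I$ that do not admit a $2$-cycle. Here $h^n$ denotes the $n$-th iterate of $h$, with $h^0$ the identity. Two real sequences $(a_n)_{n=0}^{\infty}$ and $(b_n)_{n=0}^{\infty}$ have the same order-pattern if, for all $m,n\ge 0$, $a_m<a_n\iff b_m<b_n$. *)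

theory Defs
  imports "HOL-Analysis.Analysis"
begin

(* A self-map of a set S of reals is represented by a total function on the reals that maps S
   into S; only its values on S matter. *)

definition admits_2_cycle_on :: "real set \<Rightarrow> (real \<Rightarrow> real) \<Rightarrow> bool" where
  "admits_2_cycle_on S h \<longleftrightarrow> (\<exists>u\<in>S. \<exists>v\<in>S. u \<noteq> v \<and> h u = v \<and> h v = u)"

definition F1 :: "real set \<Rightarrow> (real \<Rightarrow> real) set" where
  "F1 S = {h. continuous_on S h \<and> h ` S \<subseteq> S \<and> \<not> admits_2_cycle_on S h}"

definition same_order_pattern :: "(nat \<Rightarrow> real) \<Rightarrow> (nat \<Rightarrow> real) \<Rightarrow> bool" where
  "same_order_pattern a b \<longleftrightarrow> (\<forall>m n. a m < a n \<longleftrightarrow> b m < b n)"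

end

(* If g has no 2-cycle and g c > c, then every later point of the orbit of c stays above c (and
   symmetrically below), so the order-pattern of an orbit is determined by the signs of its
   consecutive differences.  For f one has |f x| < |x| off 0, so the differences along an orbit
   of f have the signs opposite to those of its points.  As f oscillates around 0 arbitrarily
   close to 0, a nested compactness argument produces orbits of f with any prescribed
   sequence of signs, as long as a sign 0 is only followed by 0. *)
theory Submission
  imports Defs
begin

section \<open>Orbits of interval maps without 2-cycles\<close>

lemma fixpoint_between:
  fixes h :: "real \<Rightarrow> real"
  assumes "continuous_on {a..b} h" "a \<le> b" "a \<le> h a" "h b \<le> b"
  shows "\<exists>x\<in>{a..b}. h x = x"
proof -
  have "\<exists>x\<ge>a. x \<le> b \<and> h x - x = 0"
    by (rule IVT2') (use assms in \<open>auto intro!: continuous_intros\<close>)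
  then show ?thesis by auto
qed

lemma funpow_mem:
  assumes "h ` S \<subseteq> S" "x \<in> S"
  shows "(h ^^ n) x \<in> S"
  using assms by (induction n) auto

lemma continuous_on_funpow:
  fixes h :: "'a::topological_space \<Rightarrow> 'a"
  assumes "continuous_on S h" "h ` S \<subseteq> S"
  shows "continuous_on S (h ^^ n)"
proof (induction n)
  case 0
  then show ?case by (simp add: id_def)
next
  case (Suc n)
  have "(h ^^ n) ` S \<subseteq> S" using funpow_mem[OF assms(2)] by blast
  then show ?case
    unfolding funpow.simps(2)
    by (intro continuous_on_compose Suc continuous_on_subset[OF assms(1)])
qed

lemma F1D:
  assumes "g \<in> F1 S"
  shows "continuous_on S g" "g ` S \<subseteq> S" "u \<in> S \<Longrightarrow> g (g u) = u \<Longrightarrow> g u = u"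
  using assms unfolding F1_def admits_2_cycle_on_def by (blast, blast, fastforce)

text \<open>If \<open>g (g c) < c\<close>, take the largest fixed point \<open>w\<close> of the
  second iterate in \<open>{a..c}\<close>; in the absence of 2-cycles it is also fixed by
  \<open>g\<close>. Between \<open>w\<close> and \<open>c\<close>, \<open>g\<close> then moves
  points up and its second iterate moves them down. These two facts clash at a point of this range
  whose image also lies in it.\<close>

lemma F1_less_second_iterate:
  assumes g: "g \<in> F1 {a..b}" and c: "c \<in> {a..b}" and less: "c < g c"
  shows "c < g (g c)"
proof (rule ccontr)
  assume "\<not> c < g (g c)"
  have cont: "continuous_on {a..b} g" and self: "g ` {a..b} \<subseteq> {a..b}"
    and nocyc: "\<And>u. u \<in> {a..b} \<Longrightarrow> g (g u) = u \<Longrightarrow> g u = u"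
    using F1D[OF g] by blast+
  have cont2: "continuous_on {a..b} (\<lambda>x. g (g x))"
    using continuous_on_funpow[OF cont self, of 2] by (simp add: numeral_2_eq_2 o_def)
  have below: "g (g c) < c"
    using \<open>\<not> c < g (g c)\<close> nocyc[OF c] less by force
  define A where "A = {x \<in> {a..c}. g (g x) - x = 0}"
  \<comment> \<open>\<open>A\<close> is nonempty because the second iterate cannot move the endpoint
    \<open>a\<close> down, while it moves \<open>c\<close> down.\<close>
  have "a \<in> {a..b}" using c by auto
  then have "g (g a) \<in> {a..b}" using self by blast
  then have "A \<noteq> {}"
    using fixpoint_between[of a c "\<lambda>x. g (g x)"] continuous_on_subset[OF cont2, of "{a..c}"]
      below c unfolding A_def by auto
  moreover have "compact A"
  proof -
    have "continuous_on {a..c} (\<lambda>x. g (g x) - x)"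
      using continuous_on_subset[OF cont2, of "{a..c}"] c by (auto intro!: continuous_intros)
    then have "closed A"
      unfolding A_def by (intro continuous_closed_preimage_constant) auto
    then have "compact ({a..c} \<inter> A)" by (intro compact_Int_closed) auto
    moreover have "{a..c} \<inter> A = A" unfolding A_def by blast
    ultimately show ?thesis by simp
  qed
  ultimately obtain w where w: "w \<in> A" and w_max: "\<And>t. t \<in> A \<Longrightarrow> t \<le> w"
    using compact_attains_sup[of A] by blast
  have w_bounds: "a \<le> w" "w < c" and gw: "g w = w"
    using w below c nocyc[of w] unfolding A_def by (auto simp: order.order_iff_strict)
  have up: "x < g x" if "w < x" "x \<le> c" for x
  proof (rule ccontr)
    assume "\<not> x < g x"
    have "\<exists>y\<ge>x. y \<le> c \<and> g y - y = 0"
      using that c w_bounds less \<open>\<not> x < g x\<close>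
      by (intro IVT') (auto intro!: continuous_intros continuous_on_subset[OF cont])
    then obtain y where y: "x \<le> y" "y \<le> c" "g y = y" by auto
    then have "y \<in> A" using that w_bounds unfolding A_def by auto
    then show False using w_max[of y] y that by auto
  qed
  have down: "g (g x) < x" if "w < x" "x \<le> c" for x
  proof (rule ccontr)
    assume "\<not> g (g x) < x"
    have "\<exists>y\<in>{x..c}. g (g y) = y"
      using that c w_bounds below \<open>\<not> g (g x) < x\<close>
      by (intro fixpoint_between continuous_on_subset[OF cont2]) auto
    then obtain y where y: "x \<le> y" "y \<le> c" "g (g y) = y" by auto
    then have "y \<in> A" using that w_bounds unfolding A_def by auto
    then show False using w_max[of y] y that by auto
  qed
  \<comment> \<open>The midpoint serves as a value strictly between \<open>w\<close> and
    \<open>c\<close>, so that \<open>up\<close> applies to \<open>g x\<close> as well as to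
    \<open>x\<close>.\<close>
  have "\<exists>x\<ge>w. x \<le> c \<and> g x = (w + c) / 2"
    using w_bounds gw less c by (intro IVT' continuous_on_subset[OF cont]) auto
  then obtain x where x: "w \<le> x" "x \<le> c" "g x = (w + c) / 2" by blast
  have "x \<noteq> w" using x gw w_bounds by auto
  then have "x < g x" "g (g x) < x" "g x < g (g x)"
    using up[of x] down[of x] up[of "g x"] x w_bounds by auto
  then show False by simp
qed

text \<open>If the orbit first fails to stay above \<open>c\<close> at time \<open>n\<close>, it
  must descend at all intermediate times: a rise at one of them would, by induction from that point,
  keep the \<open>n\<close>-th iterate above it and so above \<open>c\<close>. Hence the last point
  \<open>d\<close> before the failure satisfies \<open>c < d \<le> g c\<close>, and intermediate
  values give a point violating the two-step case.\<close>

lemma F1_less_iterate: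
  assumes g: "g \<in> F1 {a..b}" and "c \<in> {a..b}" and "c < g c" and "0 < n"
  shows "c < (g ^^ n) c"
  using assms(2-)
proof (induction n arbitrary: c rule: less_induct)
  case (less n)
  have cont: "continuous_on {a..b} g" and self: "g ` {a..b} \<subseteq> {a..b}"
    using F1D[OF g] by blast+
  have mem: "(g ^^ i) c \<in> {a..b}" for i using funpow_mem[OF self less.prems(1)] .
  show ?case
  proof (rule ccontr)
    assume return: "\<not> c < (g ^^ n) c"
    have "n \<noteq> 1" using return less.prems by auto
    then have n2: "2 \<le> n" using less.prems by auto
    have above: "c < (g ^^ i) c" if "0 < i" "i < n" for i
      using less.IH[of i c] that less.prems by auto
    \<comment> \<open>The induction hypothesis is used at the new starting point
      \<open>(g ^^ i) c\<close> for the remaining \<open>n - i\<close> steps, fewer than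
      \<open>n\<close> since \<open>0 < i\<close>.\<close>
    have descent: "(g ^^ Suc i) c \<le> (g ^^ i) c" if "0 < i" "i < n" for i
    proof (rule ccontr)
      assume "\<not> (g ^^ Suc i) c \<le> (g ^^ i) c"
      then have "(g ^^ i) c < (g ^^ (n - i)) ((g ^^ i) c)"
        using less.IH[of "n - i" "(g ^^ i) c"] mem that by auto
      also have "\<dots> = (g ^^ n) c"
        using that by (simp flip: funpow_add comp_apply[of "g ^^ (n - i)"])
      finally show False using above[OF that] return by auto
    qed
    define d where "d = (g ^^ (n - 1)) c"
    have gd: "g d \<le> c"
      using return n2 funpow.simps(2)[of "n - 1" g] unfolding d_def by simp
    have d_above: "c < d" using above n2 unfolding d_def by auto
    have "i < n \<Longrightarrow> 0 < i \<Longrightarrow> (g ^^ i) c \<le> g c" for i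
    proof (induction i)
      case (Suc i)
      then show ?case using descent[of i] by (cases "i = 0") auto
    qed simp
    then have d_le: "d \<le> g c" using n2 unfolding d_def by auto
    have sub: "{c..d} \<subseteq> {a..b}" using mem[of "n - 1"] less.prems unfolding d_def by auto
    obtain z where z: "z \<in> {c..d}" "g z = z"
      using fixpoint_between[of c d g] continuous_on_subset[OF cont sub] d_above d_le gd by auto
    have "z \<noteq> d" using z gd d_above by auto
    \<comment> \<open>A preimage of \<open>d\<close> lies in \<open>{c..z}\<close> since
      \<open>g z = z \<le> d \<le> g c\<close>. It rises to \<open>d\<close>, yet its second image
      \<open>g d\<close> is at most \<open>c\<close>, hence not above it.\<close>
    have "\<exists>y\<ge>c. y \<le> z \<and> g y = d"
      using z sub d_le less.prems
      by (intro IVT2' continuous_on_subset[OF cont]) auto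
    then obtain y where y: "c \<le> y" "y \<le> z" "g y = d" by blast
    have "y < g y" using y z \<open>z \<noteq> d\<close> by auto
    moreover have "y \<in> {a..b}" using y z sub by auto
    ultimately have "y < g (g y)" using F1_less_second_iterate[OF g] by blast
    then show False using y gd by simp
  qed
qed

lemma funpow_reflect:
  fixes g :: "real \<Rightarrow> real"
  shows "((\<lambda>x. - g (- x)) ^^ n) x = - (g ^^ n) (- x)"
  by (induction n) auto

text \<open>Conjugation by negation exchanges rises and falls, so the result for a falling first
  step follows from the one for a rising first step.\<close>

lemma F1_reflect:
  assumes "g \<in> F1 {a..b}"
  shows "(\<lambda>x. - g (- x)) \<in> F1 {-b..-a}"
proof -
  have cont: "continuous_on {a..b} g" and self: "\<And>x. x \<in> {a..b} \<Longrightarrow> g x \<in> {a..b}"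
    and nocyc: "\<And>u. u \<in> {a..b} \<Longrightarrow> g (g u) = u \<Longrightarrow> g u = u"
    using F1D[OF assms] by blast+
  have "continuous_on {-b..-a} (\<lambda>x. - g (- x))"
    by (intro continuous_intros continuous_on_compose2[OF cont]) auto
  moreover have "(\<lambda>x. - g (- x)) ` {-b..-a} \<subseteq> {-b..-a}"
  proof
    fix y assume "y \<in> (\<lambda>x. - g (- x)) ` {-b..-a}"
    then obtain x where "x \<in> {-b..-a}" "y = - g (- x)" by auto
    then show "y \<in> {-b..-a}" using self[of "- x"] by auto
  qed
  moreover have "\<not> admits_2_cycle_on {-b..-a} (\<lambda>x. - g (- x))"
  proof
    assume "admits_2_cycle_on {-b..-a} (\<lambda>x. - g (- x))"
    then obtain u where "u \<in> {-b..-a}" "- g (- u) \<noteq> u" "- g (g (- u)) = u"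
      unfolding admits_2_cycle_on_def by auto
    then show False using nocyc[of "- u"] by auto
  qed
  ultimately show ?thesis unfolding F1_def by auto
qed

lemma F1_greater_iterate:
  assumes g: "g \<in> F1 {a..b}" and "c \<in> {a..b}" and "g c < c" and "0 < n"
  shows "(g ^^ n) c < c"
  using F1_less_iterate[OF F1_reflect[OF g], of "- c" n] assms(2-) by (simp add: funpow_reflect)

text \<open>Restart the orbit at its \<open>m\<close>-th point: after a rise or a fall it never
  comes back to that point, and a fixed point never moves. Hence the signs of consecutive
  differences carry the whole order-pattern.\<close>

lemma F1_sgn_iterate:
  assumes g: "g \<in> F1 {a..b}" and p: "p \<in> {a..b}" and "m < n"
  shows "sgn ((g ^^ n) p - (g ^^ m) p) = sgn ((g ^^ Suc m) p - (g ^^ m) p)"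
proof -
  define c where "c = (g ^^ m) p"
  have c: "c \<in> {a..b}"
    using funpow_mem[OF F1D(2)[OF g] p] unfolding c_def .
  have fixed: "(g ^^ k) c = c" if "g c = c" for k
    using that by (induction k) auto
  have "sgn ((g ^^ (n - m)) c - c) = sgn (g c - c)"
    using F1_less_iterate[OF g c] F1_greater_iterate[OF g c] fixed \<open>m < n\<close>
    by (cases "g c" c rule: linorder_cases) auto
  moreover have "(g ^^ (n - m)) c = (g ^^ n) p"
    using \<open>m < n\<close> unfolding c_def
    by (simp flip: funpow_add comp_apply[of "g ^^ (n - m)"])
  ultimately show ?thesis by (simp add: c_def)
qed

lemma same_order_patternI:
  assumes "\<And>m n. m < n \<Longrightarrow> sgn (a n - a m) = sgn (b n - b m)"
  shows "same_order_pattern a b"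
  unfolding same_order_pattern_def
proof (intro allI)
  fix m n
  have iff: "a m < a n \<longleftrightarrow> b m < b n" "a n < a m \<longleftrightarrow> b n < b m" if "m < n" for m n
    using assms[OF that] by (auto simp: sgn_if split: if_splits)
  show "a m < a n \<longleftrightarrow> b m < b n"
    using iff by (cases m n rule: linorder_cases) auto
qed

section \<open>Itineraries\<close>

text \<open>The coverings allow a point of \<open>K n\<close> to be pulled back step by step to
  \<open>K 0\<close>, which realises every finite part of the itinerary; compactness of
  \<open>K 0\<close> gives the infinite one.\<close>

lemma itinerary_exists:
  fixes h :: "'a::t2_space \<Rightarrow> 'a" and K :: "nat \<Rightarrow> 'a set"
  assumes cont: "continuous_on S h" and self: "h ` S \<subseteq> S"
    and K: "\<And>n. compact (K n)" "\<And>n. K n \<noteq> {}" "\<And>n. K n \<subseteq> S"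
    and cover: "\<And>n. K (Suc n) \<subseteq> h ` K n"
  shows "\<exists>q. \<forall>n. (h ^^ n) q \<in> K n"
proof -
  have chain: "y \<in> K n \<Longrightarrow> \<exists>x\<in>K 0. (h ^^ n) x = y \<and> (\<forall>i\<le>n. (h ^^ i) x \<in> K i)" for n y
  proof (induction n arbitrary: y)
    case (Suc n)
    then obtain z where "z \<in> K n" "h z = y" using cover by blast
    then show ?case using Suc by (force simp: le_Suc_eq)
  qed simp
  \<comment> \<open>Each \<open>T n\<close> records only the \<open>n\<close>-th constraint; an
    orbit pulled back from beyond a finite index set satisfies all constraints of that set at
    once.\<close>
  define T where "T n = K 0 \<inter> (h ^^ n) -` K n" for n
  have "closed (T n)" for n
    unfolding T_def
    by (intro continuous_closed_preimage
        continuous_on_subset[OF continuous_on_funpow[OF cont self]] compact_imp_closed K)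
  then have "K 0 \<inter> (\<Inter>n\<in>UNIV. T n) \<noteq> {}"
  proof (rule compact_imp_fip_image[OF K(1)])
    fix J :: "nat set" assume "finite J"
    then obtain N where N: "J \<subseteq> {..N}" by (auto simp: finite_nat_iff_bounded_le)
    obtain y where "y \<in> K N" using K(2)[of N] by blast
    then obtain x where "x \<in> K 0" "\<forall>i\<le>N. (h ^^ i) x \<in> K i" using chain by blast
    then have "x \<in> K 0 \<inter> (\<Inter>n\<in>J. T n)" using N unfolding T_def by auto
    then show "K 0 \<inter> (\<Inter>n\<in>J. T n) \<noteq> {}" by blast
  qed
  then show ?thesis unfolding T_def by blast
qed

section \<open>The map $x \mapsto r x \sin (1/x)$\<close>

text \<open>The junk value \<open>1 / 0 = 0\<close> makes the formula below correct at \<open>0\<close> too.\<close>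

lemma continuous_on_x_sin_inverse: "continuous_on S (\<lambda>x::real. r * x * sin (1 / x))"
proof -
  have "isCont (\<lambda>x::real. r * x * sin (1 / x)) x" for x
  proof (cases "x = 0")
    case True
    have "((\<lambda>x. \<bar>r * x\<bar>) \<longlongrightarrow> 0) (at 0)"
      by (intro tendsto_rabs_zero tendsto_mult_right_zero tendsto_ident_at)
    moreover have "norm (r * x * sin (1 / x)) \<le> \<bar>r * x\<bar>" for x
      using mult_left_le[OF abs_sin_le_one[of "1 / x"], of "\<bar>r * x\<bar>"] by (simp add: abs_mult)
    ultimately have "((\<lambda>x. r * x * sin (1 / x)) \<longlongrightarrow> 0) (at 0)"
      by (rule Lim_null_comparison[OF always_eventually[OF allI], rotated])
    then show ?thesis using True by (simp add: isCont_def)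
  next
    case False
    then show ?thesis by (intro continuous_intros)
  qed
  then show ?thesis by (simp add: continuous_at_imp_continuous_on)
qed

lemma abs_x_sin_inverse_less:
  fixes r x :: real
  assumes "0 < r" "r < 1" "x \<noteq> 0"
  shows "\<bar>r * x * sin (1 / x)\<bar> < \<bar>x\<bar>"
proof -
  have "\<bar>r * x * sin (1 / x)\<bar> \<le> r * \<bar>x\<bar>"
    using assms by (auto simp: abs_mult intro!: mult_left_le)
  also have "\<dots> < \<bar>x\<bar>" using assms by simp
  finally show ?thesis .
qed

text \<open>The names refer to \<open>sin (1 / x)\<close>, not to extrema of
  \<open>x * sin (1 / x)\<close>: between \<open>trough k\<close> and \<open>peak k\<close> the sine
  makes one swing from \<open>-1\<close> to \<open>1\<close>.\<close>

definition peak :: "nat \<Rightarrow> real" where "peak k = 1 / (pi / 2 + 2 * pi * real k)"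

definition trough :: "nat \<Rightarrow> real" where "trough k = 1 / (3 * pi / 2 + 2 * pi * real k)"

lemma trough_bounds: "0 < trough k" "trough k < peak k"
  and peak_le_1: "peak k \<le> 1"
proof -
  have "0 \<le> 2 * pi * real k" by simp
  then have "0 < pi / 2 + 2 * pi * real k" "0 < 3 * pi / 2 + 2 * pi * real k"
    "pi / 2 + 2 * pi * real k < 3 * pi / 2 + 2 * pi * real k"
    "1 \<le> pi / 2 + 2 * pi * real k"
    using pi_gt3 by linarith+
  then show "0 < trough k" "trough k < peak k" "peak k \<le> 1"
    unfolding trough_def peak_def by (simp_all only: divide_strict_left_mono mult_pos_pos zero_less_divide_1_iff
        divide_le_eq_1_pos zero_less_one)
qed

lemma sin_inverse_peak: "sin (1 / peak k) = 1"
  and sin_inverse_trough: "sin (1 / trough k) = - 1"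
proof -
  have "sin (2 * pi * real k) = 0" "cos (2 * pi * real k) = 1"
    using sin_2npi[of k] cos_2npi[of k] by (simp_all add: mult_ac)
  moreover have "sin (3 * pi / 2) = - 1" using sin_3over2_pi by simp
  ultimately show "sin (1 / peak k) = 1" "sin (1 / trough k) = - 1"
    unfolding peak_def trough_def by (simp_all add: sin_add)
qed

lemma ex_peak_le:
  assumes "0 < e"
  shows "\<exists>k. peak k \<le> e"
proof -
  obtain k :: nat where k: "1 / e \<le> real k" using real_arch_simple by blast
  also have "real k \<le> pi / 2 + 2 * pi * real k"
    using pi_gt3 mult_right_mono[of 1 "2 * pi" "real k"] by simp
  finally have "1 / e \<le> pi / 2 + 2 * pi * real k" .
  then have "1 / (pi / 2 + 2 * pi * real k) \<le> 1 / (1 / e)"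
    using assms by (intro frac_le) auto
  then show ?thesis unfolding peak_def by auto
qed

text \<open>The map takes the value \<open>- r * trough k\<close> at the trough and
  \<open>r * peak k\<close>, which is larger than \<open>r * trough k\<close>, at the peak, so
  intermediate values suffice. Since the map is even, the mirrored interval, \<open>e = - 1\<close>,
  has the same image.\<close>

lemma x_sin_inverse_covers:
  fixes r :: real
  assumes "0 < r" and "\<bar>e\<bar> = 1" and "\<bar>y\<bar> \<le> r * trough k"
  shows "\<exists>x\<in>{trough k..peak k}. r * (e * x) * sin (1 / (e * x)) = y"
proof -
  have "\<exists>x\<ge>trough k. x \<le> peak k \<and> r * x * sin (1 / x) = y"
  proof (rule IVT')
    show "r * trough k * sin (1 / trough k) \<le> y"
      using assms by (simp only: sin_inverse_trough)
    have "r * trough k \<le> r * peak k" using assms trough_bounds[of k] by simp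
    then show "y \<le> r * peak k * sin (1 / peak k)"
      using assms by (simp only: sin_inverse_peak)
  qed (use trough_bounds[of k] in \<open>auto intro: continuous_on_x_sin_inverse\<close>)
  moreover have "e = 1 \<or> e = - 1" using assms by auto
  ultimately show ?thesis by auto
qed

text \<open>Each prescribed sign picks a swing interval right or left of \<open>0\<close>, or the
  point \<open>0\<close> itself. Swings chosen successively close enough to \<open>0\<close> cover
  one another in the sense required for an itinerary. A sign \<open>0\<close> has to persist because
  \<open>0\<close> is fixed.\<close>

lemma x_sin_inverse_sign_sequence:
  fixes r :: real and e :: "nat \<Rightarrow> real"
  assumes r: "0 < r" "r < 1"
    and f: "\<And>x. x \<in> {-1..1} \<Longrightarrow> f x = r * x * sin (1 / x)"
    and e: "\<And>n. sgn (e n) = e n" "\<And>n. e n = 0 \<Longrightarrow> e (Suc n) = 0"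
    and cont: "continuous_on {-1..1} f" and self: "f ` {-1..1} \<subseteq> {-1..1}"
  shows "\<exists>q\<in>{-1..1}. \<forall>n. sgn ((f ^^ n) q) = e n"
proof -
  have "\<exists>j. peak j \<le> r * trough k" for k
    using ex_peak_le r trough_bounds by simp
  then obtain N where N: "\<And>k. peak (N k) \<le> r * trough k" by metis
  \<comment> \<open>Iterating the choice \<open>N\<close> puts the swing at time
    \<open>Suc n\<close> within distance \<open>r * trough (\<kappa> n)\<close> of \<open>0\<close>,
    the range covered from the swing at time \<open>n\<close>.\<close>
  define \<kappa> where "\<kappa> n = (N ^^ n) 0" for n
  \<comment> \<open>Multiplication by \<open>e n\<close> treats the three signs uniformly: it keeps
    the interval, mirrors it, or collapses it to \<open>{0}\<close>.\<close>
  define K where "K n = (*) (e n) ` {trough (\<kappa> n)..peak (\<kappa> n)}" for n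
  have e_cases: "e n = 0 \<or> e n = 1 \<or> e n = - 1" for n
    using e(1)[of n] by (auto simp: sgn_if split: if_splits)
  have K_bound: "\<bar>y\<bar> \<le> peak (\<kappa> n)" if "y \<in> K n" for y n
    using that e_cases[of n] trough_bounds[of "\<kappa> n"] unfolding K_def by (auto simp: abs_mult)
  have K_sub: "K n \<subseteq> {-1..1}" for n
  proof
    fix y assume "y \<in> K n"
    then show "y \<in> {-1..1}" using K_bound[of y n] peak_le_1[of "\<kappa> n"] by auto
  qed
  have K_ne: "K n \<noteq> {}" for n
    unfolding K_def using trough_bounds(2)[of "\<kappa> n"] by simp
  have "\<exists>q. \<forall>n. (f ^^ n) q \<in> K n"
  proof (rule itinerary_exists[OF cont self _ K_ne K_sub])
    show "compact (K n)" for n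
      unfolding K_def by (intro compact_continuous_image continuous_intros) auto
    show "K (Suc n) \<subseteq> f ` K n" for n
    proof
      fix y assume y: "y \<in> K (Suc n)"
      have "\<exists>x\<in>K n. r * x * sin (1 / x) = y"
      proof (cases "e n = 0")
        case True
        \<comment> \<open>Both \<open>K n\<close> and \<open>K (Suc n)\<close> are
          \<open>{0}\<close> here, as the sign \<open>0\<close> persists.\<close>
        then show ?thesis using y e(2)[of n] K_ne[of n] unfolding K_def by auto
      next
        case False
        have "\<bar>y\<bar> \<le> r * trough (\<kappa> n)"
          using K_bound[OF y] N[of "\<kappa> n"] unfolding \<kappa>_def by simp
        moreover have "\<bar>e n\<bar> = 1" using False e_cases[of n] by auto
        ultimately show ?thesis
          using x_sin_inverse_covers[OF r(1), of "e n" y "\<kappa> n"] unfolding K_def by auto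
      qed
      then show "y \<in> f ` K n" using f K_sub by (metis imageI subsetD)
    qed
  qed
  then obtain q where q: "\<And>n. (f ^^ n) q \<in> K n" by blast
  have "sgn ((f ^^ n) q) = e n" for n
  proof -
    obtain x where "x \<in> {trough (\<kappa> n)..peak (\<kappa> n)}" "(f ^^ n) q = e n * x"
      using q[of n] unfolding K_def by blast
    then show ?thesis using trough_bounds(1)[of "\<kappa> n"] e(1)[of n] by (simp add: sgn_mult)
  qed
  moreover have "q \<in> {-1..1}" using q[of 0] K_sub[of 0] by auto
  ultimately show ?thesis by blast
qed

theorem mainTheorem2:
  fixes r :: real and I :: "real set" and f :: "real \<Rightarrow> real"
  assumes "0 < r" and "r < 1"
    and "I = {-1..1}"
    and "\<And>x. x \<in> I \<Longrightarrow> x \<noteq> 0 \<Longrightarrow> f x = r * x * sin (1 / x)"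
    and "f 0 = 0"
  shows "f \<in> F1 I \<and>
    (\<forall>g \<in> F1 I. \<forall>p \<in> I. \<exists>q \<in> I.
       same_order_pattern (\<lambda>n. (g ^^ n) p) (\<lambda>n. (f ^^ n) q))"
proof
  have f: "f x = r * x * sin (1 / x)" if "x \<in> {-1..1}" for x
    using assms that by (cases "x = 0") auto
  have shrink: "\<bar>f x\<bar> < \<bar>x\<bar>" if "x \<in> {-1..1}" "x \<noteq> 0" for x
    using abs_x_sin_inverse_less[OF assms(1,2)] f that by auto
  have cont: "continuous_on {-1..1} f"
    using continuous_on_x_sin_inverse continuous_on_cong f by (metis (no_types, lifting))
  have self: "f ` {-1..1} \<subseteq> {-1..1}"
  proof
    fix y assume "y \<in> f ` {-1..1}"
    then obtain x where "x \<in> {-1..1}" "y = f x" by blast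
    then show "y \<in> {-1..1}" using shrink[of x] \<open>f 0 = 0\<close> by (cases "x = 0") auto
  qed
  have "\<not> admits_2_cycle_on {-1..1} f"
  proof
    assume "admits_2_cycle_on {-1..1} f"
    then obtain u v where uv: "u \<in> {-1..1}" "v \<in> {-1..1}" "u \<noteq> v" "f u = v" "f v = u"
      unfolding admits_2_cycle_on_def by blast
    then have "u \<noteq> 0" "v \<noteq> 0" using \<open>f 0 = 0\<close> by auto
    \<comment> \<open>Both points of the cycle would be strictly smaller in absolute value than the
      other.\<close>
    then show False using shrink[of u] shrink[of v] uv by auto
  qed
  then have f_F1: "f \<in> F1 {-1..1}" using cont self unfolding F1_def by simp
  then show "f \<in> F1 I" using assms by simp
  show "\<forall>g \<in> F1 I. \<forall>p \<in> I. \<exists>q \<in> I.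
       same_order_pattern (\<lambda>n. (g ^^ n) p) (\<lambda>n. (f ^^ n) q)"
  proof (intro ballI)
    fix g p assume "g \<in> F1 I" "p \<in> I"
    then have g: "g \<in> F1 {-1..1}" and p: "p \<in> {-1..1}" using assms by auto
    \<comment> \<open>The minus sign appears because \<open>f\<close> moves every nonzero point
      \<open>x\<close> in the direction of \<open>- sgn x\<close>. A zero difference means that
      \<open>g\<close> has reached a fixed point, so zeros of \<open>e\<close> persist.\<close>
    define e where "e n = - sgn ((g ^^ Suc n) p - (g ^^ n) p)" for n
    have "\<exists>q\<in>{-1..1}. \<forall>n. sgn ((f ^^ n) q) = e n"
      by (rule x_sin_inverse_sign_sequence[OF assms(1,2) f _ _ cont self])
        (auto simp: e_def sgn_minus sgn_eq_0_iff)
    then obtain q where q: "q \<in> {-1..1}" "\<And>n. sgn ((f ^^ n) q) = e n" by blast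
    have f_sgn: "sgn (f x - x) = - sgn x" if "x \<in> {-1..1}" for x
      using shrink[OF that] \<open>f 0 = 0\<close> by (cases "x = 0") (auto simp: sgn_if abs_if split: if_splits)
    have "same_order_pattern (\<lambda>n. (g ^^ n) p) (\<lambda>n. (f ^^ n) q)"
    proof (rule same_order_patternI)
      fix m n :: nat assume "m < n"
      have "sgn ((f ^^ n) q - (f ^^ m) q) = - e m"
        using F1_sgn_iterate[OF f_F1 q(1) \<open>m < n\<close>] f_sgn[OF funpow_mem[OF self q(1)]] q(2)
        by simp
      then show "sgn ((g ^^ n) p - (g ^^ m) p) = sgn ((f ^^ n) q - (f ^^ m) q)"
        using F1_sgn_iterate[OF g p \<open>m < n\<close>] by (simp add: e_def)
    qed
    then show "\<exists>q \<in> I. same_order_pattern (\<lambda>n. (g ^^ n) p) (\<lambda>n. (f ^^ n) q)"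
      using q(1) assms(3) by blast
  qed
qed

end
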